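(* For any $\alpha,\beta,p,q>0$, there does not exist a finite-degree polynomial map from $\mathcal{E}_\alpha^p$ into $\mathcal{L}_\beta^q$; that is, there is no real polynomial $P:\mathbb{R}\to\mathbb{R}$ such that $P(X)\in\mathcal{L}_\beta^q$ for every $X\in\mathcal{E}_\alpha^p$.
   Context: For $\alpha,p>0$, and with asymptotics taken as $x\to\infty$: - $\mathcal{E}_\alpha^p$ is the set of real-valued random variables $X$ with $\mathbb{P}(|X|\ge x)=\Theta(e^{-\alpha x^p})$; - $\mathcal{L}_\alpha^p$ is the set of real-valued random variables $X$ with $\mathbb{P}(|X|\ge x)=\Theta(e^{-\alpha(\log x)^p})$. *)

theory Defs
  imports "HOL-Probability.Probability" "HOL-Computational_Algebra.Polynomial"
begin

text \<open>
  A random variable is represented together with the probability space carrying it,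
  as a pair \<open>(M, X)\<close>, so that the two classes below are not tied to one particular space
  (which might be too small to carry any variable with the prescribed tail).
\<close>

definition real_random_variables :: "('a measure \<times> ('a \<Rightarrow> real)) set" where
  "real_random_variables = {(M, X). prob_space M \<and> X \<in> borel_measurable M}"

definition tail_prob :: "'a measure \<Rightarrow> ('a \<Rightarrow> real) \<Rightarrow> real \<Rightarrow> real" where
  "tail_prob M X x = measure M {\<omega> \<in> space M. \<bar>X \<omega>\<bar> \<ge> x}"

definition exp_tail_class :: "real \<Rightarrow> real \<Rightarrow> ('a measure \<times> ('a \<Rightarrow> real)) set" where
  "exp_tail_class \<alpha> p = {(M, X) \<in> real_random_variables.
     tail_prob M X \<in> \<Theta>[at_top](\<lambda>x. exp (- \<alpha> * x powr p))}"

definition log_tail_class :: "real \<Rightarrow> real \<Rightarrow> ('a measure \<times> ('a \<Rightarrow> real)) set" where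
  "log_tail_class \<alpha> p = {(M, X) \<in> real_random_variables.
     tail_prob M X \<in> \<Theta>[at_top](\<lambda>x. exp (- \<alpha> * ln x powr p))}"

text \<open>
  A polynomial maps one class into another if it does so by post-composition, the underlying
  probability space being unchanged.
\<close>

definition poly_maps_into ::
  "real poly \<Rightarrow> ('a measure \<times> ('a \<Rightarrow> real)) set \<Rightarrow> ('a measure \<times> ('a \<Rightarrow> real)) set \<Rightarrow> bool" where
  "poly_maps_into P A B \<longleftrightarrow> (\<forall>(M, X) \<in> A. (M, \<lambda>\<omega>. poly P (X \<omega>)) \<in> B)"

text \<open>
  HOL cannot quantify over the type of sample points inside a formula. Sample points of type
  \<^typ>\<open>real\<close> (with arbitrary \<open>\<sigma>\<close>-algebra and probability measure) realise every law on the line,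
  and since membership in the classes depends only on the law, this is no restriction. (For the
  non-existence of a polynomial map, fewer sample spaces only make the claim harder.)
\<close>

type_synonym real_rv = "real measure \<times> (real \<Rightarrow> real)"

end

theory Submission imports Defs "HOL-Real_Asymp.Real_Asymp" begin

text \<open>
  If \<open>n\<close> exceeds the degree of \<open>P\<close>, then \<open>\<bar>P x\<bar> \<ge> s ^ n\<close> forces \<open>\<bar>x\<bar> \<ge> s\<close> for large \<open>s\<close>, so the tail
  of \<open>P X\<close> at \<open>s ^ n\<close> is at most the tail of \<open>X\<close> at \<open>s\<close>, which is of order \<open>exp (- \<alpha> * s powr p)\<close>. A variable
  of log-tail class would have there a tail of order \<open>exp (- \<beta> * (n * ln s) powr q)\<close>, which is far larger.
  A variable to which this applies is obtained from the uniform distribution on \<open>(0, 1]\<close> by inversion.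
\<close>

text \<open>Induction along \<open>pCons\<close>: each Horner step costs one factor
  \<open>s\<close>, and \<open>1 \<le> s\<close> lets the new coefficient be absorbed into the
  leading power.\<close>

lemma poly_abs_bound:
  fixes P :: "'a :: linordered_idom poly"
  obtains C where "\<And>x s. \<bar>x\<bar> \<le> s \<Longrightarrow> 1 \<le> s \<Longrightarrow> \<bar>poly P x\<bar> \<le> C * s ^ degree P"
proof -
  have "\<exists>C\<ge>0. \<forall>x s. \<bar>x\<bar> \<le> s \<longrightarrow> 1 \<le> s \<longrightarrow> \<bar>poly P x\<bar> \<le> C * s ^ degree P"
  proof (induction P)
    case 0
    then show ?case by auto
  next
    case (pCons a P)
    then obtain C where C: "C \<ge> 0" "\<And>x s. \<bar>x\<bar> \<le> s \<Longrightarrow> 1 \<le> s \<Longrightarrow> \<bar>poly P x\<bar> \<le> C * s ^ degree P"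
      by blast
    show ?case
    \<comment> \<open>For \<open>P = 0\<close> the degree does not grow under \<open>pCons\<close>,
      so constants are treated apart.\<close>
    proof (cases "P = 0")
      case True
      then show ?thesis by (intro exI[of _ "\<bar>a\<bar>"]) auto
    next
      case False
      have "\<bar>poly (pCons a P) x\<bar> \<le> (\<bar>a\<bar> + C) * s ^ degree (pCons a P)" if s: "\<bar>x\<bar> \<le> s" "1 \<le> s" for x s
      proof -
        have "\<bar>poly (pCons a P) x\<bar> \<le> \<bar>a\<bar> + \<bar>x\<bar> * \<bar>poly P x\<bar>"
          by (metis abs_mult abs_triangle_ineq poly_pCons)
        also have "\<dots> \<le> \<bar>a\<bar> * s ^ Suc (degree P) + s * (C * s ^ degree P)"
          using s C one_le_power[OF s(2), of "Suc (degree P)"]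
          by (intro add_mono mult_mono) (auto simp: mult_le_cancel_left1)
        also have "\<dots> = (\<bar>a\<bar> + C) * s ^ degree (pCons a P)"
          using False by (simp add: algebra_simps)
        finally show ?thesis .
      qed
      then show ?thesis using C(1) by (intro exI[of _ "\<bar>a\<bar> + C"]) auto
    qed
  qed
  then show thesis using that by blast
qed

text \<open>The spare factor \<open>s\<close> in \<open>s ^ n\<close> eventually exceeds the
  constant of the polynomial bound. The threshold is uniform in \<open>x\<close>, so it applies to
  all sample points at once.\<close>

lemma eventually_poly_abs_less_power:
  fixes P :: "real poly"
  assumes "degree P < n"
  shows "\<forall>\<^sub>F s in at_top. \<forall>x. \<bar>x\<bar> < s \<longrightarrow> \<bar>poly P x\<bar> < s ^ n"
proof -
  obtain C where C: "\<And>x s. \<bar>x\<bar> \<le> s \<Longrightarrow> 1 \<le> s \<Longrightarrow> \<bar>poly P x\<bar> \<le> C * s ^ degree P"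
    using poly_abs_bound by blast
  show ?thesis
    using eventually_gt_at_top[of C] eventually_ge_at_top[of 1]
  proof eventually_elim
    case (elim s)
    have "C * s ^ degree P < s * s ^ degree P"
      using elim by (intro mult_strict_right_mono) auto
    also have "\<dots> \<le> s ^ n"
      using power_increasing[of "Suc (degree P)" n s] assms elim by simp
    finally show ?case
      using C elim by (meson le_less_trans less_imp_le)
  qed
qed

lemma eventually_tail_prob_poly_le:
  assumes "(M, X) \<in> real_random_variables" and "degree P < n"
  shows "\<forall>\<^sub>F s in at_top. tail_prob M (\<lambda>\<omega>. poly P (X \<omega>)) (s ^ n) \<le> tail_prob M X s"
  using eventually_poly_abs_less_power[OF assms(2)]
proof eventually_elim
  case (elim s)
  interpret prob_space M using assms(1) by (simp add: real_random_variables_def)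
  have [measurable]: "X \<in> borel_measurable M"
    using assms(1) by (simp add: real_random_variables_def)
  show ?case
    unfolding tail_prob_def
  proof (rule finite_measure_mono)
    show "{\<omega> \<in> space M. s ^ n \<le> \<bar>poly P (X \<omega>)\<bar>} \<subseteq> {\<omega> \<in> space M. s \<le> \<bar>X \<omega>\<bar>}"
      using elim by (auto simp flip: not_less)
  qed measurable
qed

text \<open>On an empty class \<open>poly_maps_into\<close> would hold vacuously, so a witness is
  essential.\<close>

lemma exp_tail_class_nonempty:
  fixes \<alpha> p :: real
  assumes "\<alpha> > 0" "p > 0"
  obtains M and X where "((M, X) :: real_rv) \<in> exp_tail_class \<alpha> p"
proof -
  define M :: "real measure" where "M = restrict_space lborel {0<..1}"
  \<comment> \<open>This is the inverse of the target tail
    \<open>x \<mapsto> exp (- \<alpha> * x powr p)\<close>, evaluated at a uniform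
    \<open>u\<close>.\<close>
  define X :: "real \<Rightarrow> real" where "X u = (- ln u / \<alpha>) powr (1 / p)" for u
  have "prob_space M"
    unfolding M_def by (rule prob_space_restrict_space) auto
  moreover have "X \<in> borel_measurable M"
    unfolding M_def X_def by (rule measurable_restrict_space1) measurable
  moreover have "tail_prob M X \<in> \<Theta>[at_top](\<lambda>x. exp (- \<alpha> * x powr p))"
  proof (rule bigthetaI_cong)
    show "\<forall>\<^sub>F x in at_top. tail_prob M X x = exp (- \<alpha> * x powr p)"
      using eventually_gt_at_top[of 0]
    proof eventually_elim
      case (elim x)
      have "x \<le> \<bar>X u\<bar> \<longleftrightarrow> u \<le> exp (- \<alpha> * x powr p)" if u: "0 < u" "u \<le> 1" for u
      proof -
        \<comment> \<open>Monotonicity of \<open>powr\<close> in its base needs nonnegative bases;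
          here \<open>u \<le> 1\<close> provides this.\<close>
        have nonneg: "0 \<le> - ln u / \<alpha>"
          using u assms by (simp add: divide_le_0_iff)
        have "x \<le> \<bar>X u\<bar> \<longleftrightarrow> (x powr p) powr (1 / p) \<le> (- ln u / \<alpha>) powr (1 / p)"
          using elim assms by (simp add: X_def powr_powr)
        also have "\<dots> \<longleftrightarrow> x powr p \<le> - ln u / \<alpha>"
          using assms nonneg powr_mono2[of "1 / p" "x powr p" "- ln u / \<alpha>"]
            powr_less_mono2[of "1 / p" "- ln u / \<alpha>" "x powr p"]
          by (auto simp flip: not_less)
        also have "\<dots> \<longleftrightarrow> ln u \<le> - \<alpha> * x powr p"
          using assms by (auto simp: field_simps)
        also have "\<dots> \<longleftrightarrow> u \<le> exp (- \<alpha> * x powr p)"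
          using u by (metis exp_le_cancel_iff exp_ln)
        finally show ?thesis .
      qed
      \<comment> \<open>This keeps the interval found for \<open>u\<close> inside the sample space,
        so its measure is its full length.\<close>
      moreover have "exp (- \<alpha> * x powr p) \<le> 1"
        using assms by simp
      moreover have "space M = {0<..1}"
        by (simp add: M_def space_restrict_space)
      ultimately have "{u \<in> space M. x \<le> \<bar>X u\<bar>} = {0<..exp (- \<alpha> * x powr p)}"
        by (auto simp del: exp_le_one_iff)
      moreover have "measure M {0<..exp (- \<alpha> * x powr p)} = measure lborel {0<..exp (- \<alpha> * x powr p)}"
        unfolding M_def using \<open>exp (- \<alpha> * x powr p) \<le> 1\<close>
        by (intro measure_restrict_space) (auto simp del: exp_le_one_iff)
      ultimately show ?case
        by (simp add: tail_prob_def)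
    qed
  qed
  ultimately show thesis
    using that by (simp add: exp_tail_class_def real_random_variables_def)
qed

text \<open>Any positive power of \<open>s\<close> outgrows any power of \<open>ln s\<close>, so the
  exponent of the quotient tends to minus infinity. The factor \<open>c\<close> accommodates
  \<open>ln (s ^ n) = n * ln s\<close>.\<close>

lemma exp_tail_smallo_log_tail:
  fixes \<alpha> \<beta> p q c :: real
  assumes "\<alpha> > 0" "\<beta> > 0" "p > 0" "q > 0" "c > 0"
  shows "(\<lambda>s. exp (- \<alpha> * s powr p)) \<in> o(\<lambda>s. exp (- \<beta> * (c * ln s) powr q))"
proof (rule smalloI_tendsto)
  have "filterlim (\<lambda>s. \<beta> * (c * ln s) powr q - \<alpha> * s powr p) at_bot at_top"
    using assms by real_asymp
  then have "((\<lambda>s. exp (\<beta> * (c * ln s) powr q - \<alpha> * s powr p)) \<longlongrightarrow> 0) at_top"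
    by (rule filterlim_compose[OF exp_at_bot])
  then show "((\<lambda>s. exp (- \<alpha> * s powr p) / exp (- \<beta> * (c * ln s) powr q)) \<longlongrightarrow> 0) at_top"
    by (simp flip: exp_diff)
qed simp

theorem corollary3p4:
  fixes \<alpha> \<beta> p q :: real
  assumes "\<alpha> > 0" and "\<beta> > 0" and "p > 0" and "q > 0"
  shows "\<not> (\<exists>P :: real poly.
    poly_maps_into P (exp_tail_class \<alpha> p :: real_rv set) (log_tail_class \<beta> q))"
proof
  assume "\<exists>P :: real poly. poly_maps_into P (exp_tail_class \<alpha> p :: real_rv set) (log_tail_class \<beta> q)"
  then obtain P :: "real poly" where
    P: "poly_maps_into P (exp_tail_class \<alpha> p :: real_rv set) (log_tail_class \<beta> q)" by blast
  obtain M and X where MX: "((M, X) :: real_rv) \<in> exp_tail_class \<alpha> p"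
    using exp_tail_class_nonempty assms by blast
  define Y where "Y = (\<lambda>\<omega>. poly P (X \<omega>))"
  \<comment> \<open>The successor also makes \<open>n\<close> positive for constant
    \<open>P\<close>, so that \<open>s ^ n\<close> still tends to infinity.\<close>
  define n where "n = Suc (degree P)"
  have X: "(M, X) \<in> real_random_variables" "tail_prob M X \<in> \<Theta>(\<lambda>x. exp (- \<alpha> * x powr p))"
    using MX by (simp_all add: exp_tail_class_def)
  have Y: "tail_prob M Y \<in> \<Theta>(\<lambda>x. exp (- \<beta> * ln x powr q))"
    using P MX by (auto simp: poly_maps_into_def log_tail_class_def Y_def)
  let ?g = "\<lambda>s. exp (- \<beta> * (real n * ln s) powr q)"
  have "filterlim (\<lambda>s::real. s ^ n) at_top at_top"
    by (rule filterlim_pow_at_top) (auto simp: n_def filterlim_ident)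
  \<comment> \<open>The lower bound on the tail of \<open>Y\<close>, read off by symmetry of Theta,
    is evaluated along \<open>s ^ n\<close>.\<close>
  then have "(\<lambda>s. exp (- \<beta> * ln (s ^ n) powr q)) \<in> O(\<lambda>s. tail_prob M Y (s ^ n))"
    by (rule landau_o.big.compose[OF bigthetaD1[OF Y[unfolded bigtheta_sym[of "tail_prob M Y"]]]])
  moreover have "\<forall>\<^sub>F s in at_top. exp (- \<beta> * ln (s ^ n) powr q) = ?g s"
    using eventually_gt_at_top[of 0] by eventually_elim (simp add: ln_realpow)
  ultimately have "?g \<in> O(\<lambda>s. tail_prob M Y (s ^ n))"
    using landau_o.big.in_cong by fast
  also have "(\<lambda>s. tail_prob M Y (s ^ n)) \<in> O(tail_prob M X)"
  proof (rule bigoI[of _ 1])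
    show "\<forall>\<^sub>F s in at_top. norm (tail_prob M Y (s ^ n)) \<le> 1 * norm (tail_prob M X s)"
      using eventually_tail_prob_poly_le[OF X(1), of P n]
      by (simp add: Y_def n_def tail_prob_def)
  qed
  also have "tail_prob M X \<in> O(\<lambda>s. exp (- \<alpha> * s powr p))"
    using X(2) by (rule bigthetaD1)
  also have "(\<lambda>s. exp (- \<alpha> * s powr p)) \<in> o(?g)"
    using assms by (intro exp_tail_smallo_log_tail) (auto simp: n_def)
  finally have "?g \<in> o(?g)" .
  \<comment> \<open>A function is little-o of itself only if it vanishes eventually, which an
    exponential never does.\<close>
  then show False
    by (simp add: landau_o.small_refl_iff)
qed

end
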